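(* Let $J_\pm(n,2,-1)$ be the graph whose vertex set consists of all vectors $v\in\{-1,0,1\}^n$ with exactly $2$ nonzero coordinates (i.e. of Euclidean length $\sqrt{2}$), two vertices being adjacent if and only if their standard scalar product equals $-1$. Then for all integers $n\ge 2$, \[ \log_2 n \;\le\; \chi\big(J_\pm(n,2,-1)\big) \;\le\; \log_2 n + \left(\tfrac12 + o(1)\right)\log_2\log_2 n, \] where $\chi$ denotes the chromatic number and $o(1)$ denotes a quantity tending to $0$ as $n\to\infty$.
   Context: The chromatic number $\chi(G)$ of a graph $G$ is the minimum number of colors in a coloring of the vertices such that adjacent vertices receive different colors. *)

theory Defs
  imports "Graph_Theory.Pair_Digraph" "Jordan_Normal_Form.Matrix"
begin

definition proper_coloring :: "'a pair_pre_digraph \<Rightarrow> nat \<Rightarrow> ('a \<Rightarrow> nat) \<Rightarrow> bool" where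
  "proper_coloring G k c \<longleftrightarrow>
     c ` pverts G \<subseteq> {..<k} \<and> (\<forall>(u, v) \<in> parcs G. c u \<noteq> c v)"

definition chromatic_number :: "'a pair_pre_digraph \<Rightarrow> nat" where
  "chromatic_number G = (LEAST k. \<exists>c. proper_coloring G k c)"

text \<open>The minimum is attained for every finite simple graph, so \<open>LEAST\<close> is not vacuous here.\<close>

lemma chromatic_number_attained:
  assumes "pair_graph G"
  shows "\<exists>c. proper_coloring G (chromatic_number G) c"
proof -
  interpret pair_graph G by fact
  have "finite (pverts G)" by (rule pair_finite_verts)
  then obtain f :: "'a \<Rightarrow> nat" where f: "bij_betw f (pverts G) {..<card (pverts G)}"
    using ex_bij_betw_finite_nat[of "pverts G"] by (auto simp: atLeast0LessThan)
  have "f u \<noteq> f v" if "(u, v) \<in> parcs G" for u v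
  proof -
    have "u \<in> pverts G" "v \<in> pverts G" "u \<noteq> v"
      using that wellformed no_loops by fastforce+
    with f show ?thesis by (auto simp: bij_betw_def inj_on_def)
  qed
  with f have "proper_coloring G (card (pverts G)) f"
    by (auto simp: proper_coloring_def bij_betw_def)
  then have "\<exists>k c. proper_coloring G k c" by blast
  then show ?thesis unfolding chromatic_number_def by (rule LeastI_ex)
qed

definition J_verts :: "nat \<Rightarrow> int vec set" where
  "J_verts n = {v \<in> carrier_vec n.
     (\<forall>i<n. v $ i \<in> {-1, 0, 1}) \<and> card {i. i < n \<and> v $ i \<noteq> 0} = 2}"

definition J_graph :: "nat \<Rightarrow> int vec pair_pre_digraph" where
  "J_graph n = \<lparr>pverts = J_verts n,
     parcs = {(u, v). u \<in> J_verts n \<and> v \<in> J_verts n \<and> u \<bullet> v = -1}\<rparr>"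

lemma finite_J_verts: "finite (J_verts n)"
proof (rule finite_subset)
  show "J_verts n \<subseteq> vec_of_list ` {xs. set xs \<subseteq> {-1, 0, 1} \<and> length xs = n}"
  proof
    fix v assume v: "v \<in> J_verts n"
    then have "set (list_of_vec v) \<subseteq> {-1, 0, 1} \<and> length (list_of_vec v) = n"
      by (auto simp: J_verts_def in_set_conv_nth list_of_vec_index) 
    moreover have "v = vec_of_list (list_of_vec v)" by (simp add: vec_list)
    ultimately show "v \<in> vec_of_list ` {xs. set xs \<subseteq> {-1, 0, 1} \<and> length xs = n}" by blast
  qed
  show "finite (vec_of_list ` {xs :: int list. set xs \<subseteq> {-1, 0, 1} \<and> length xs = n})"
    by (intro finite_imageI finite_lists_length_eq) simp
qed

text \<open>Symmetric digraphs without loops represent undirected simple graphs.\<close>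

lemma pair_graph_J: "pair_graph (J_graph n)"
proof
  show "finite (pverts (J_graph n))" by (simp add: J_graph_def finite_J_verts)
  have "parcs (J_graph n) \<subseteq> J_verts n \<times> J_verts n" by (auto simp: J_graph_def)
  then show "finite (parcs (J_graph n))"
    by (rule finite_subset) (simp add: finite_J_verts)
  show "fst e \<noteq> snd e" if e: "e \<in> parcs (J_graph n)" for e
  proof
    assume "fst e = snd e"
    with e have "fst e \<bullet> fst e = -1" by (auto simp: J_graph_def)
    moreover have "0 \<le> fst e \<bullet> fst e"
      by (auto simp: scalar_prod_def intro!: sum_nonneg)
    ultimately show False by simp
  qed
  show "symmetric (J_graph n)"
    by (auto simp: symmetric_def arcs_ends_def arc_to_ends_def sym_def with_proj_def J_graph_def
        J_verts_def comm_scalar_prod)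
qed (auto simp: J_graph_def)

end

theory Submission
  imports Defs "HOL-Real_Asymp.Real_Asymp"
begin

text \<open>
  Lower bound: in a proper colouring, the sets of colours of the vectors \<open>e\<^sub>i - e\<^sub>j\<close> with \<open>j > i\<close>
  are pairwise distinct, as the colour of \<open>e\<^sub>i - e\<^sub>j\<close> cannot be that of any \<open>e\<^sub>j - e\<^sub>l\<close>.

  Upper bound: let \<open>S\<^sub>1, \<dots>, S\<^sub>n\<close> be sets of colours such that any two of them are in
  general position, i.e. split the colours into four nonempty parts. Then a vector \<open>v\<close> can be given
  a colour that, for each \<open>i\<close> in the support of \<open>v\<close>, lies in \<open>S\<^sub>i\<close> if \<open>v\<^sub>i = 1\<close> and outside \<open>S\<^sub>i\<close>
  if \<open>v\<^sub>i = -1\<close>. This is proper because adjacent vectors have opposite signs at some position. The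
  \<open>(p+1)\<close>-subsets of a \<open>(2p+2)\<close>-set containing a fixed point are in general position, so
  \<open>2p + 2\<close> colours suffice as soon as \<open>n \<le> (2p+1 choose p)\<close>, a number of order \<open>4\<^sup>p / \<surd>p\<close>.
\<close>

lemma chromatic_number_le:
  assumes "proper_coloring G k c"
  shows "chromatic_number G \<le> k"
  unfolding chromatic_number_def using assms by (intro Least_le) blast

section \<open>Lower bound\<close>

definition diff_vec :: "nat \<Rightarrow> nat \<Rightarrow> nat \<Rightarrow> int vec" where
  "diff_vec n i j = vec n (\<lambda>k. if k = i then 1 else if k = j then -1 else 0)"

lemma diff_vec_in_J_verts:
  assumes "i < n" "j < n" "i \<noteq> j"
  shows "diff_vec n i j \<in> J_verts n"
proof -
  have "{k. k < n \<and> diff_vec n i j $ k \<noteq> 0} = {i, j}"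
    using assms by (auto simp: diff_vec_def split: if_splits)
  then show ?thesis
    using assms by (auto simp: J_verts_def diff_vec_def)
qed

lemma scalar_prod_diff_vec:
  assumes "i < j" "j < l" "l < n"
  shows "diff_vec n i j \<bullet> diff_vec n j l = -1"
proof -
  have "diff_vec n i j \<bullet> diff_vec n j l = (\<Sum>k = 0..<n. if k = j then -1 else 0)"
    unfolding scalar_prod_def using assms
    by (intro sum.cong) (auto simp: diff_vec_def)
  also have "\<dots> = -1"
    using assms by simp
  finally show ?thesis .
qed

lemma J_graph_coloring_lower_bound:
  assumes "proper_coloring (J_graph n) k c"
  shows "n \<le> 2 ^ k"
proof -
  \<comment> \<open>For n \<ge> 1 the last set \<open>A (n - 1)\<close> is empty; it still counts as
    one of the n distinct subsets of the k colours.\<close>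
  define A where "A i = {c (diff_vec n i j) | j. i < j \<and> j < n}" for i
  have less: "A i \<noteq> A j" if "i < j" "j < n" for i j
  proof
    assume "A i = A j"
    moreover have "c (diff_vec n i j) \<in> A i"
      using that by (auto simp: A_def)
    ultimately obtain l where l: "j < l" "l < n" "c (diff_vec n i j) = c (diff_vec n j l)"
      by (auto simp: A_def)
    then have "(diff_vec n i j, diff_vec n j l) \<in> parcs (J_graph n)"
      using that by (simp add: J_graph_def diff_vec_in_J_verts scalar_prod_diff_vec)
    with l assms show False
      by (auto simp: proper_coloring_def)
  qed
  have "inj_on A {..<n}"
  proof (rule inj_onI)
    fix i j assume "i \<in> {..<n}" "j \<in> {..<n}" "A i = A j"
    then show "i = j"
      using less[of i j] less[of j i] by (cases i j rule: linorder_cases) auto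
  qed
  moreover have "A ` {..<n} \<subseteq> Pow {..<k}"
  proof -
    have "c (diff_vec n i j) < k" if "i < j" "j < n" for i j
      using assms diff_vec_in_J_verts[of i n j] that
      by (auto simp: proper_coloring_def J_graph_def image_subset_iff)
    then show ?thesis by (auto simp: A_def)
  qed
  ultimately have "card {..<n} \<le> card (Pow {..<k})"
    by (intro card_inj_on_le) auto
  then show ?thesis
    by (simp add: card_Pow)
qed

section \<open>Upper bound\<close>

text \<open>Any two of the sets share the added point \<open>2 * p + 1\<close>; being distinct and
  of equal size p + 1, neither contains the other; and since they overlap, their union misses one of
  the 2p + 2 points. \<open>P\<close> and \<open>Q\<close> select one of the four parts.\<close>

lemma general_position_family:
  assumes "n \<le> (2 * p + 1) choose p"
  obtains S :: "nat \<Rightarrow> nat set" where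
    "\<And>a b P Q. a < n \<Longrightarrow> b < n \<Longrightarrow> a \<noteq> b \<Longrightarrow>
       \<exists>x < 2 * p + 2. (x \<in> S a \<longleftrightarrow> P) \<and> (x \<in> S b \<longleftrightarrow> Q)"
proof -
  let ?F = "{B. B \<subseteq> {..<2 * p + 1} \<and> card B = p}"
  have "card {..<n} \<le> card ?F"
    using assms by (simp add: n_subsets)
  moreover have "finite ?F" by simp
  ultimately obtain f where f: "f ` {..<n} \<subseteq> ?F" "inj_on f {..<n}"
    using card_le_inj[of "{..<n}" ?F] by auto
  define S where "S a = insert (2 * p + 1) (f a)" for a
  have f_sub: "f a \<subseteq> {..<2 * p + 1}" and card_f: "card (f a) = p" if "a < n" for a
    using f that by auto
  have fin: "finite (S a)" if "a < n" for a
    using f_sub[OF that] by (auto simp: S_def intro: finite_subset)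
  have card_S: "card (S a) = p + 1" if "a < n" for a
  proof -
    have "finite (f a)" "2 * p + 1 \<notin> f a"
      using f_sub[OF that] by (auto intro: finite_subset)
    then show ?thesis
      using card_f[OF that] by (simp add: S_def)
  qed
  have S_sub: "S a \<subseteq> {..<2 * p + 2}" if "a < n" for a
    using f_sub[OF that] by (auto simp: S_def)
  have not_sub: "\<not> S a \<subseteq> S b" if "a < n" "b < n" "a \<noteq> b" for a b
  proof
    assume "S a \<subseteq> S b"
    then have "S a = S b"
      using that by (intro card_subset_eq) (simp_all add: fin card_S)
    moreover have "2 * p + 1 \<notin> f a" "2 * p + 1 \<notin> f b"
      using f_sub[of a] f_sub[of b] that by auto
    ultimately have "f a = f b"
      unfolding S_def by (metis insert_ident)
    with f(2) that show False
      by (auto simp: inj_on_def)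
  qed
  have not_cover: "\<not> {..<2 * p + 2} \<subseteq> S a \<union> S b" if "a < n" "b < n" for a b
  proof
    assume "{..<2 * p + 2} \<subseteq> S a \<union> S b"
    then have "card {..<2 * p + 2} \<le> card (S a \<union> S b)"
      using that by (intro card_mono) (simp_all add: fin)
    moreover have "card (S a \<union> S b) + card (S a \<inter> S b) = 2 * p + 2"
      using that card_Un_Int[of "S a" "S b"] by (simp add: fin card_S)
    moreover have "card (S a \<inter> S b) > 0"
      using that fin[of a] by (auto simp: card_gt_0_iff S_def)
    ultimately show False by simp
  qed
  show ?thesis
  proof (rule that)
    fix a b P Q assume ab: "a < n" "b < n" "a \<noteq> b"
    have "\<exists>x<2 * p + 2. x \<in> S a \<and> x \<in> S b"
      by (intro exI[of _ "2 * p + 1"]) (simp add: S_def)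
    moreover have "\<exists>x<2 * p + 2. x \<in> S a \<and> x \<notin> S b"
      using not_sub[of a b] S_sub[of a] ab by auto
    moreover have "\<exists>x<2 * p + 2. x \<notin> S a \<and> x \<in> S b"
      using not_sub[of b a] S_sub[of b] ab by auto
    moreover have "\<exists>x<2 * p + 2. x \<notin> S a \<and> x \<notin> S b"
      using not_cover[of a b] ab by auto
    ultimately show "\<exists>x<2 * p + 2. (x \<in> S a \<longleftrightarrow> P) \<and> (x \<in> S b \<longleftrightarrow> Q)"
      by (cases P; cases Q) simp_all
  qed
qed

lemma chromatic_number_J_graph_le:
  assumes "n \<le> (2 * p + 1) choose p"
  shows "chromatic_number (J_graph n) \<le> 2 * p + 2"
proof -
  obtain S :: "nat \<Rightarrow> nat set" where S:
    "\<And>a b P Q. a < n \<Longrightarrow> b < n \<Longrightarrow> a \<noteq> b \<Longrightarrow>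
       \<exists>x < 2 * p + 2. (x \<in> S a \<longleftrightarrow> P) \<and> (x \<in> S b \<longleftrightarrow> Q)"
    using general_position_family[OF assms] by blast
  let ?good = "\<lambda>v x. x < 2 * p + 2 \<and> (\<forall>i<n. v $ i \<noteq> 0 \<longrightarrow> (x \<in> S i \<longleftrightarrow> v $ i = 1))"
  have "\<exists>x. ?good v x" if v: "v \<in> J_verts n" for v
  proof -
    obtain a b where ab: "{i. i < n \<and> v $ i \<noteq> 0} = {a, b}" "a \<noteq> b"
      using v by (auto simp: J_verts_def card_2_iff)
    then have "a < n" "b < n" by auto
    then obtain x where "x < 2 * p + 2" "x \<in> S a \<longleftrightarrow> v $ a = 1" "x \<in> S b \<longleftrightarrow> v $ b = 1"
      using S[of a b "v $ a = 1" "v $ b = 1"] ab(2) by blast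
    moreover have "i = a \<or> i = b" if "i < n" "v $ i \<noteq> 0" for i
      using ab(1) that by blast
    ultimately show ?thesis by blast
  qed
  then obtain c where c: "\<And>v. v \<in> J_verts n \<Longrightarrow> ?good v (c v)"
    by metis
  have "c u \<noteq> c v" if uv: "u \<in> J_verts n" "v \<in> J_verts n" "u \<bullet> v = -1" for u v
  proof -
    \<comment> \<open>Nonnegative products cannot sum to -1, so u and v have opposite signs at some
      i, and \<open>S i\<close> separates their colours.\<close>
    have "\<not> (\<forall>i\<in>{0..<n}. 0 \<le> u $ i * v $ i)"
    proof
      assume "\<forall>i\<in>{0..<n}. 0 \<le> u $ i * v $ i"
      then have "0 \<le> (\<Sum>i = 0..<n. u $ i * v $ i)"
        by (intro sum_nonneg) blast
      also have "\<dots> = u \<bullet> v"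
        using uv by (auto simp: scalar_prod_def J_verts_def)
      finally have "0 \<le> u \<bullet> v" .
      with uv show False by simp
    qed
    then obtain i where i: "i < n" "u $ i * v $ i < 0"
      by (auto simp: not_le)
    moreover have "u $ i \<in> {-1, 0, 1}" "v $ i \<in> {-1, 0, 1}"
      using uv i by (auto simp: J_verts_def)
    ultimately have "u $ i \<noteq> 0" "v $ i \<noteq> 0" "u $ i = 1 \<longleftrightarrow> v $ i \<noteq> 1"
      by auto
    then show ?thesis
      using c[OF uv(1)] c[OF uv(2)] i(1) by metis
  qed
  then have "proper_coloring (J_graph n) (2 * p + 2) c"
    using c by (auto simp: proper_coloring_def J_graph_def)
  then show ?thesis
    by (rule chromatic_number_le)
qed

text \<open>At n = 2 the iterated logarithm is 0, so no error term can absorb a constant and the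
  exact value is needed. There are no edges: both coordinates are \<plusminus>1, so every scalar
  product is even.\<close>

lemma chromatic_number_J_graph_2: "chromatic_number (J_graph 2) \<le> 1"
proof -
  have ends: "v $ 0 \<in> {-1, 1} \<and> v $ 1 \<in> {-1, 1} \<and> dim_vec v = 2" if "v \<in> J_verts 2" for v
  proof -
    have "{i. i < 2 \<and> v $ i \<noteq> 0} = {..<2}"
      using that by (intro card_subset_eq) (auto simp: J_verts_def)
    then have "0 \<in> {i. i < 2 \<and> v $ i \<noteq> 0}" "1 \<in> {i. i < 2 \<and> v $ i \<noteq> 0}"
      by auto
    then show ?thesis
      using that less_2_cases_iff by (auto 0 3 simp: J_verts_def)
  qed
  have "u \<bullet> v \<noteq> -1" if "u \<in> J_verts 2" "v \<in> J_verts 2" for u v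
    using ends[OF that(1)] ends[OF that(2)]
    by (auto simp: scalar_prod_def numeral_2_eq_2)
  then have "proper_coloring (J_graph 2) 1 (\<lambda>_. 0)"
    by (auto simp: proper_coloring_def J_graph_def)
  then show ?thesis
    by (rule chromatic_number_le)
qed

section \<open>Asymptotics of the central binomial coefficient\<close>

text \<open>Absorption is applied twice, joined by the symmetry of row
  \<open>2 * n + 1\<close>.\<close>

lemma central_binomial_Suc:
  "(n + 1) * ((2 * n + 2) choose (n + 1)) = 2 * (2 * n + 1) * ((2 * n) choose n)"
proof -
  have "(n + 1) * ((2 * n + 2) choose (n + 1)) = (2 * n + 2) * ((2 * n + 1) choose n)"
    using Suc_times_binomial_eq[of "2 * n + 1" n] by (simp add: algebra_simps)
  also have "(2 * n + 1) choose n = (2 * n + 1) choose (n + 1)"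
    by (subst binomial_symmetric) simp_all
  also have "(2 * n + 2) * ((2 * n + 1) choose (n + 1))
      = 2 * ((n + 1) * ((2 * n + 1) choose (n + 1)))"
    by simp
  also have "(n + 1) * ((2 * n + 1) choose (n + 1)) = (2 * n + 1) * ((2 * n) choose n)"
    using Suc_times_binomial_eq[of "2 * n" n] by (simp add: algebra_simps)
  finally show ?thesis by simp
qed

text \<open>The bound 4^n / (2 sqrt n) for the central coefficient, squared so that the induction
  stays in the naturals.\<close>

lemma central_binomial_square_ge:
  assumes "n \<ge> 1"
  shows "16 ^ n \<le> 4 * n * ((2 * n) choose n)\<^sup>2"
  using assms
proof (induction n rule: dec_induct)
  case base
  show ?case by (simp add: eval_nat_numeral)
next
  case (step n)
  let ?C = "(2 * n) choose n" and ?D = "(2 * n + 2) choose (n + 1)"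
  have "(n + 1) * 16 ^ Suc n = 16 * (n + 1) * 16 ^ n" by (simp add: algebra_simps)
  also have "\<dots> \<le> 16 * (n + 1) * (4 * n * ?C\<^sup>2)"
    using step.IH by (intro mult_left_mono) auto
  also have "\<dots> = 16 * (4 * (n * (n + 1))) * ?C\<^sup>2" by (simp add: algebra_simps)
  \<comment> \<open>The only loss in the induction step: 4n(n + 1) is one less than (2n +
    1)^2.\<close>
  also have "\<dots> \<le> 16 * (2 * n + 1)\<^sup>2 * ?C\<^sup>2"
    by (intro mult_right_mono mult_left_mono) (auto simp: power2_eq_square algebra_simps)
  also have "\<dots> = 4 * (2 * (2 * n + 1) * ?C)\<^sup>2"
    unfolding power_mult_distrib by simp
  also have "2 * (2 * n + 1) * ?C = (n + 1) * ?D" by (rule central_binomial_Suc[symmetric])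
  also have "4 * ((n + 1) * ?D)\<^sup>2 = (n + 1) * (4 * (n + 1) * ?D\<^sup>2)"
    by (simp only: power2_eq_square ac_simps)
  finally have "16 ^ Suc n \<le> 4 * (n + 1) * ?D\<^sup>2"
    by (rule mult_left_le_imp_le) simp
  then show ?case by simp
qed

text \<open>This coefficient is half the central one. It is the capacity at p - 1, which n exceeds
  when p is chosen least.\<close>

lemma log_near_central_binomial_ge:
  assumes "p \<ge> 1"
  shows "2 * real p - 2 - log 2 p / 2 \<le> log 2 ((2 * p - 1) choose (p - 1))"
proof -
  have "2 * p * ((2 * p - 1) choose (p - 1)) = p * ((2 * p) choose p)"
    using times_binomial_minus1_eq[of p "2 * p"] assms by simp
  then have C: "(2 * p) choose p = 2 * ((2 * p - 1) choose (p - 1))"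
    using assms by simp
  define B where "B = real ((2 * p - 1) choose (p - 1))"
  have B: "B > 0" using assms by (simp add: B_def)
  have "real (16 ^ p) \<le> real (4 * p * ((2 * p) choose p)\<^sup>2)"
    using central_binomial_square_ge[OF assms] of_nat_le_iff by blast
  then have "16 ^ p \<le> 16 * real p * B\<^sup>2"
    by (simp add: C B_def power_mult_distrib)
  then have "log 2 (2 powr (4 * real p)) \<le> log 2 (2 powr 4 * real p * B\<^sup>2)"
    using assms B by (subst log_le_cancel_iff) (auto simp: powr_realpow powr_powr[symmetric])
  then have "4 * real p \<le> log 2 (2 powr 4) + log 2 p + 2 * log 2 B"
    using assms B by (simp add: log_mult log_nat_power del: powr_numeral)
  then have "4 * real p \<le> 4 + log 2 p + 2 * log 2 B"
    by (simp only: log_powr_cancel)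
  then show ?thesis by (simp add: B_def)
qed

section \<open>Choice of p and the final bounds\<close>

lemma log2_le_self:
  assumes "p \<ge> 1"
  shows "log 2 (real p) \<le> p"
proof -
  have "real p \<le> 2 powr real p"
    using less_exp[of p] by (simp add: powr_realpow flip: of_nat_le_iff of_nat_power)
  then show ?thesis
    using assms by (simp add: log_le_iff)
qed

lemma chromatic_number_J_graph_log_le:
  assumes "n \<ge> 2"
  shows "real (chromatic_number (J_graph n)) \<le> log 2 n + log 2 (log 2 n) / 2 + 9 / 2"
proof -
  define p where "p = (LEAST p. n \<le> (2 * p + 1) choose p)"
  have "n \<le> (2 * n + 1) choose n"
  proof -
    have "(2 * n + 1) choose 1 \<le> (2 * n + 1) choose n"
      using assms by (intro binomial_mono) auto
    then show ?thesis by simp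
  qed
  then have p: "n \<le> (2 * p + 1) choose p"
    unfolding p_def by (rule LeastI)
  have p1: "p \<ge> 1"
    using p assms by (cases p) auto
  have "\<not> n \<le> (2 * (p - 1) + 1) choose (p - 1)"
    using p1 unfolding p_def by (intro not_less_Least) auto
  then have less: "(2 * p - 1) choose (p - 1) < n"
    using p1 by (cases p) (simp_all add: not_le)
  define L where "L = log 2 (real n)"
  have L: "L \<ge> 1"
    using assms by (simp add: L_def le_log_iff)
  have "log 2 ((2 * p - 1) choose (p - 1)) \<le> L"
    unfolding L_def using less p1 by (subst log_le_cancel_iff) auto
  then have *: "2 * real p \<le> L + 2 + log 2 p / 2"
    using log_near_central_binomial_ge[OF p1] by linarith
  \<comment> \<open>Bootstrapping: the crude bound log p \<le> p gives 3p/2 \<le> L + 2 \<le> 3L,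
    which then yields the sharper log p \<le> 1 + log L.\<close>
  with log2_le_self[OF p1] L have "real p \<le> 2 * L"
    by linarith
  then have "log 2 p \<le> log 2 (2 * L)"
    using p1 L by (subst log_le_cancel_iff) auto
  also have "\<dots> = 1 + log 2 L"
    using L by (simp add: log_mult)
  \<comment> \<open>The constant 9/2 is 2 from \<open>*\<close>, 1/2 from the factor 2 in 2L, and 2
    from the number of colours 2p + 2.\<close>
  finally have "2 * real p + 2 \<le> L + log 2 L / 2 + 9 / 2"
    using * by simp
  moreover have "real (chromatic_number (J_graph n)) \<le> real (2 * p + 2)"
    using chromatic_number_J_graph_le[OF p] of_nat_le_iff by blast
  ultimately show ?thesis
    by (simp add: L_def)
qed

theorem theorem1:
  shows "\<exists>e :: nat \<Rightarrow> real. e \<longlonglongrightarrow> 0 \<and>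
    (\<forall>n::nat. n \<ge> 2 \<longrightarrow>
      log 2 (real n) \<le> real (chromatic_number (J_graph n)) \<and>
      real (chromatic_number (J_graph n))
        \<le> log 2 (real n) + (1 / 2 + e n) * log 2 (log 2 (real n)))"
proof (intro exI conjI allI impI)
  \<comment> \<open>Chosen so that the error term contributes exactly 9/2 for n > 2; at n = 2 its
    product with the iterated logarithm is 0.\<close>
  let ?e = "\<lambda>n::nat. (9 / 2) / log 2 (log 2 (real n))"
  show "?e \<longlonglongrightarrow> 0"
    by real_asymp
  fix n :: nat assume n: "n \<ge> 2"
  obtain c where "proper_coloring (J_graph n) (chromatic_number (J_graph n)) c"
    using chromatic_number_attained[OF pair_graph_J] by blast
  then have "real n \<le> 2 ^ chromatic_number (J_graph n)"
    using J_graph_coloring_lower_bound by (metis of_nat_le_iff of_nat_numeral of_nat_power)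
  then show "log 2 (real n) \<le> real (chromatic_number (J_graph n))"
    using n by (simp add: log_le_iff powr_realpow)
  show "real (chromatic_number (J_graph n))
        \<le> log 2 (real n) + (1 / 2 + ?e n) * log 2 (log 2 (real n))"
  proof (cases "n = 2")
    case True
    then show ?thesis
      using chromatic_number_J_graph_2 by simp
  next
    case False
    then have "log 2 (real n) > 1"
      using n by (simp add: less_log_iff)
    then have "log 2 (log 2 (real n)) > 0"
      by simp
    then have "(1 / 2 + ?e n) * log 2 (log 2 (real n)) = log 2 (log 2 (real n)) / 2 + 9 / 2"
      by (simp add: distrib_right)
    then show ?thesis
      using chromatic_number_J_graph_log_le[OF n] by simp
  qed
qed

end
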